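(* Let $u:\mathbb{R}_{\ge0}^2\to\mathbb{R}_{\ge0}$ be a doubly increasing function such that $u(0,t)=u(t,0)=0$ for all $t\ge0$. Then, for any $C>0$ there is a continuous doubly increasing function $\tilde u$ on $\mathbb{R}_{\ge0}^2$ such that $0\le\tilde u\le u$ everywhere and $\frac{\partial\tilde u}{\partial x}\frac{\partial\tilde u}{\partial y}\ge C$ on the set where $\tilde u\ne u$ and $\tilde u$ is differentiable.
   Context: For $A\subseteq\mathbb{R}^2$, a function $u:A\to\mathbb{R}$ is doubly increasing if $u(x_1,y_1)\le u(x_2,y_2)$ whenever $(x_1,y_1),(x_2,y_2)\in A$, $x_1\le x_2$ and $y_1\le y_2$. *)

theory Defs
  imports "HOL-Analysis.Analysis"
begin

definition doubly_increasing_on :: "(real \<times> real) set \<Rightarrow> (real \<times> real \<Rightarrow> real) \<Rightarrow> bool" where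
  "doubly_increasing_on A u \<longleftrightarrow>
     (\<forall>x1 y1 x2 y2. (x1, y1) \<in> A \<longrightarrow> (x2, y2) \<in> A \<longrightarrow> x1 \<le> x2 \<longrightarrow> y1 \<le> y2
        \<longrightarrow> u (x1, y1) \<le> u (x2, y2))"

definition quadrant :: "(real \<times> real) set" where
  "quadrant = {0..} \<times> {0..}"

text \<open>Partial derivatives are two-sided derivatives of the slices. At a point interior to a set
  they depend only on the values of the function on that set.\<close>

definition partial_x :: "(real \<times> real \<Rightarrow> real) \<Rightarrow> real \<Rightarrow> real \<Rightarrow> real" where
  "partial_x f x y = deriv (\<lambda>s. f (s, y)) x"

definition partial_y :: "(real \<times> real \<Rightarrow> real) \<Rightarrow> real \<Rightarrow> real \<Rightarrow> real" where
  "partial_y f x y = deriv (\<lambda>t. f (x, t)) y"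

end

theory Submission
  imports Defs
begin

text \<open>
  The support function of \<open>{(a, b) | a b \<ge> C}\<close> with \<open>a, b > 0\<close> is
  \<open>inf (a s + b t) = 2 sqrt (C s t)\<close>. Take for \<open>v\<close> the least nonnegative function \<open>w\<close>
  with \<open>w (p + (s, t)) \<ge> min (w p + 2 sqrt (C s t)) (u p)\<close> for all \<open>s, t \<ge> 0\<close>; as \<open>u\<close> itself
  qualifies, \<open>v \<le> u\<close>. At a point with \<open>v < u\<close> the minimum is eventually its first argument,
  so the directional derivatives satisfy \<open>a s + b t \<ge> 2 sqrt (C s t)\<close>, that is, \<open>a b \<ge> C\<close>.
  Continuity follows from minimality: to the right of a vertical line \<open>x = x0\<close> the function
  \<open>v (x0, y) + 2 sqrt (C (x - x0) y)\<close> is a competitor, and symmetrically above a horizontal line.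
\<close>

section \<open>The growth condition, its least solution and their symmetry\<close>

definition growing :: "(real \<times> real \<Rightarrow> real) \<Rightarrow> real \<Rightarrow> (real \<times> real \<Rightarrow> real) \<Rightarrow> bool" where
  "growing u C w \<longleftrightarrow>
     (\<forall>x\<ge>0. \<forall>y\<ge>0. 0 \<le> w (x, y) \<and>
        (\<forall>s\<ge>0. \<forall>t\<ge>0. min (w (x, y) + 2 * sqrt (C * s * t)) (u (x, y)) \<le> w (x + s, y + t)))"

text \<open>The infimum is meaningful only on the quadrant, where competitors are bounded below by
  0; at other points they are unconstrained.\<close>

definition least_growing :: "(real \<times> real \<Rightarrow> real) \<Rightarrow> real \<Rightarrow> real \<times> real \<Rightarrow> real" where
  "least_growing u C p = (INF w\<in>{w. growing u C w}. w p)"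

lemma growingI:
  assumes "\<And>x y. 0 \<le> x \<Longrightarrow> 0 \<le> y \<Longrightarrow> 0 \<le> w (x, y)"
    and "\<And>x y s t. 0 \<le> x \<Longrightarrow> 0 \<le> y \<Longrightarrow> 0 \<le> s \<Longrightarrow> 0 \<le> t \<Longrightarrow>
           min (w (x, y) + 2 * sqrt (C * s * t)) (u (x, y)) \<le> w (x + s, y + t)"
  shows "growing u C w"
  using assms unfolding growing_def by blast

lemma growing_nonneg: "growing u C w \<Longrightarrow> 0 \<le> x \<Longrightarrow> 0 \<le> y \<Longrightarrow> 0 \<le> w (x, y)"
  unfolding growing_def by blast

lemma growing_step:
  "growing u C w \<Longrightarrow> 0 \<le> x \<Longrightarrow> 0 \<le> y \<Longrightarrow> 0 \<le> s \<Longrightarrow> 0 \<le> t \<Longrightarrow>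
     min (w (x, y) + 2 * sqrt (C * s * t)) (u (x, y)) \<le> w (x + s, y + t)"
  unfolding growing_def by blast

lemma growing_swap:
  assumes "growing u C w"
  shows "growing (u \<circ> prod.swap) C (w \<circ> prod.swap)"
proof (rule growingI)
  show "0 \<le> (w \<circ> prod.swap) (x, y)" if "0 \<le> x" "0 \<le> y" for x y
    using growing_nonneg[OF assms that(2,1)] by simp
next
  fix x y s t :: real
  assume "0 \<le> x" "0 \<le> y" "0 \<le> s" "0 \<le> t"
  then show "min ((w \<circ> prod.swap) (x, y) + 2 * sqrt (C * s * t)) ((u \<circ> prod.swap) (x, y))
      \<le> (w \<circ> prod.swap) (x + s, y + t)"
    using growing_step[OF assms, of y x t s] by (simp add: mult.assoc mult.commute[of t s])
qed

text \<open>Composition with \<open>prod.swap\<close> is a bijection between the two classes of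
  competitors, so both infima range over the same values. Estimates in \<open>y\<close> can thus be
  read off from those in \<open>x\<close>.\<close>

lemma least_growing_swap: "least_growing (u \<circ> prod.swap) C (y, x) = least_growing u C (x, y)"
proof -
  have "(\<lambda>w. w (y, x)) ` {w. growing (u \<circ> prod.swap) C w} = (\<lambda>w. w (x, y)) ` {w. growing u C w}"
    (is "?L = ?R")
  proof (intro equalityI subsetI)
    fix c assume "c \<in> ?L"
    then obtain w where "growing (u \<circ> prod.swap) C w" "c = w (y, x)" by auto
    then show "c \<in> ?R"
      using growing_swap[of "u \<circ> prod.swap" C w]
      by (intro image_eqI[where x = "w \<circ> prod.swap"]) (simp_all add: o_assoc[symmetric])
  next
    fix c assume "c \<in> ?R"
    then obtain w where "growing u C w" "c = w (x, y)" by auto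
    then show "c \<in> ?L"
      using growing_swap[of u C w] by (intro image_eqI[where x = "w \<circ> prod.swap"]) simp_all
  qed
  then show ?thesis unfolding least_growing_def by simp
qed

section \<open>Inequalities for the gain \<open>2 * sqrt (C * s * t)\<close>\<close>

lemma sqrt_cauchy_schwarz:
  fixes a b s t :: real
  assumes "0 \<le> a" "0 \<le> b" "0 \<le> s" "0 \<le> t"
  shows "sqrt (a * b) + sqrt (s * t) \<le> sqrt ((a + s) * (b + t))"
proof (rule real_le_rsqrt)
  \<comment> \<open>This square is exactly the difference of the two sides of the goal.\<close>
  have "0 \<le> (sqrt (a * t) - sqrt (s * b))\<^sup>2" by simp
  moreover have "sqrt (a * t) * sqrt (s * b) = sqrt (a * b) * sqrt (s * t)"
    by (simp add: real_sqrt_mult[symmetric] algebra_simps)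
  ultimately show "(sqrt (a * b) + sqrt (s * t))\<^sup>2 \<le> (a + s) * (b + t)"
    using assms by (simp add: power2_sum power2_diff algebra_simps)
qed

lemma gain_add:
  fixes C a b s t :: real
  assumes "0 \<le> C" "0 \<le> a" "0 \<le> b" "0 \<le> s" "0 \<le> t"
  shows "2 * sqrt (C * a * b) + 2 * sqrt (C * s * t) \<le> 2 * sqrt (C * (a + s) * (b + t))"
  using sqrt_cauchy_schwarz[of "C * a" b "C * s" t] assms by (simp add: algebra_simps)

text \<open>Subadditivity of the square root separates the widths \<open>a\<close> before and
  \<open>b\<close> after a vertical line. Raising the height in the second term to
  \<open>y + t\<close> fits the competitor of \<open>v_increment_x\<close>, whose gain is measured
  from the horizontal axis.\<close>

lemma gain_split:
  fixes C a b y t :: real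
  assumes "0 \<le> C" "0 \<le> a" "0 \<le> b" "0 \<le> y" "0 \<le> t"
  shows "2 * sqrt (C * (a + b) * t) \<le> 2 * sqrt (C * a * t) + 2 * sqrt (C * b * (y + t))"
proof -
  have "C * (a + b) * t = C * a * t + C * b * t" by (simp add: algebra_simps)
  then have "sqrt (C * (a + b) * t) \<le> sqrt (C * a * t) + sqrt (C * b * t)"
    using sqrt_add_le_add_sqrt[of "C * a * t" "C * b * t"] assms by simp
  also have "sqrt (C * b * t) \<le> sqrt (C * b * (y + t))"
    using assms by (intro real_sqrt_le_mono mult_left_mono) auto
  finally show ?thesis by simp
qed

section \<open>The least growing function: bounds and monotonicity\<close>

locale growth_problem =
  fixes u :: "real \<times> real \<Rightarrow> real" and C :: real
  assumes nonneg: "\<And>p. p \<in> quadrant \<Longrightarrow> 0 \<le> u p"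
    and incr: "doubly_increasing_on quadrant u"
    and C_nonneg: "0 \<le> C"
begin

abbreviation v where "v \<equiv> least_growing u C"

lemma u_mono: "0 \<le> x \<Longrightarrow> 0 \<le> y \<Longrightarrow> x \<le> x' \<Longrightarrow> y \<le> y' \<Longrightarrow> u (x, y) \<le> u (x', y')"
  using incr unfolding doubly_increasing_on_def quadrant_def by simp

text \<open>The cap in the growth condition is the value of \<open>u\<close> at the base point, so
  monotonicity of \<open>u\<close> suffices.\<close>

lemma growing_u: "growing u C u"
  by (rule growingI) (auto simp: quadrant_def intro!: nonneg min.coboundedI2 u_mono)

lemma v_le: "growing u C w \<Longrightarrow> 0 \<le> x \<Longrightarrow> 0 \<le> y \<Longrightarrow> v (x, y) \<le> w (x, y)"
  unfolding least_growing_def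
  by (rule cINF_lower) (auto intro!: bdd_belowI[where m = 0] growing_nonneg[of u C])

lemma v_ge: "(\<And>w. growing u C w \<Longrightarrow> c \<le> w p) \<Longrightarrow> c \<le> v p"
  unfolding least_growing_def using growing_u by (intro cINF_greatest) auto

text \<open>The left side of the growth condition is monotone in \<open>w (x, y)\<close>, so the
  condition survives the pointwise infimum.\<close>

lemma growing_v: "growing u C v"
proof (rule growingI)
  show "0 \<le> v (x, y)" if "0 \<le> x" "0 \<le> y" for x y
    using that by (auto intro: v_ge growing_nonneg[of u C])
next
  fix x y s t :: real
  assume nn: "0 \<le> x" "0 \<le> y" "0 \<le> s" "0 \<le> t"
  show "min (v (x, y) + 2 * sqrt (C * s * t)) (u (x, y)) \<le> v (x + s, y + t)"
  proof (rule v_ge)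
    fix w assume w: "growing u C w"
    show "min (v (x, y) + 2 * sqrt (C * s * t)) (u (x, y)) \<le> w (x + s, y + t)"
      using growing_step[OF w nn] v_le[OF w nn(1,2)] by linarith
  qed
qed

lemmas v_nonneg = growing_nonneg[OF growing_v]
lemmas v_step = growing_step[OF growing_v]
lemmas v_le_u = v_le[OF growing_u]

lemma v_mono:
  assumes "0 \<le> x" "0 \<le> y" "x \<le> x'" "y \<le> y'"
  shows "v (x, y) \<le> v (x', y')"
proof -
  have "v (x, y) \<le> v (x', y)"
    using v_step[of x y "x' - x" 0] v_le_u[of x y] assms by simp
  also have "\<dots> \<le> v (x', y')"
    using v_step[of x' y 0 "y' - y"] v_le_u[of x' y] assms by simp
  finally show ?thesis .
qed

section \<open>Modulus of continuity\<close>

lemma v_increment_x: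
  assumes x0: "0 \<le> x0" and le: "x0 \<le> x" and y: "0 \<le> y"
  shows "v (x, y) \<le> v (x0, y) + 2 * sqrt (C * (x - x0) * y)"
proof -
  define g where "g x y = v (x0, y) + 2 * sqrt (C * (x - x0) * y)" for x y
  \<comment> \<open>\<open>v\<close> is cut down to at most \<open>g\<close> to the right of the
    line \<open>x = x0\<close>. Once \<open>w\<close> is known to be a competitor, minimality gives
    \<open>v \<le> w \<le> g\<close> there.\<close>
  define w where "w = (\<lambda>(x, y). if x \<le> x0 then v (x, y) else min (v (x, y)) (g x y))"
  have w_le_v: "w (x, y) \<le> v (x, y)" for x y by (simp add: w_def)
  have "growing u C w"
  proof (rule growingI)
    show "0 \<le> w (x, y)" if "0 \<le> x" "0 \<le> y" for x y
      using that x0 C_nonneg by (auto simp: w_def g_def v_nonneg)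
  next
    fix x y s t :: real
    assume nn: "0 \<le> x" "0 \<le> y" "0 \<le> s" "0 \<le> t"
    let ?m = "min (w (x, y) + 2 * sqrt (C * s * t)) (u (x, y))"
    have to_v: "?m \<le> v (x + s, y + t)"
      using v_step[OF nn] w_le_v[of x y] by linarith
    have to_g: "?m \<le> g (x + s) (y + t)" if "x0 < x + s"
    proof (cases "x \<le> x0")
      \<comment> \<open>The step crosses the line: \<open>v\<close> grows up to
        \<open>(x0, y + t)\<close>, and \<open>g\<close> covers the rest of the gain. If the minimum
        is \<open>u (x, y)\<close> instead, nonnegativity of the last gain suffices.\<close>
      case True
      have "min (v (x, y) + 2 * sqrt (C * (x0 - x) * t)) (u (x, y)) \<le> v (x0, y + t)"
        using v_step[of x y "x0 - x" t] nn True by simp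
      moreover have "2 * sqrt (C * s * t) \<le>
          2 * sqrt (C * (x0 - x) * t) + 2 * sqrt (C * (x + s - x0) * (y + t))"
        using gain_split[of C "x0 - x" "x + s - x0" y t] C_nonneg nn True that by simp
      moreover have "0 \<le> 2 * sqrt (C * (x + s - x0) * (y + t))"
        using C_nonneg nn that by simp
      ultimately show ?thesis
        using w_le_v[of x y] unfolding g_def by linarith
    next
      \<comment> \<open>The step starts to the right of the line, where the gain already in
        \<open>g\<close> and that of the step combine by superadditivity.\<close>
      case False
      have "2 * sqrt (C * (x - x0) * y) + 2 * sqrt (C * s * t)
          \<le> 2 * sqrt (C * (x + s - x0) * (y + t))"
        using gain_add[of C "x - x0" y s t] C_nonneg nn False by (simp add: algebra_simps)
      moreover have "v (x0, y) \<le> v (x0, y + t)"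
        using x0 nn by (intro v_mono) auto
      moreover have "w (x, y) \<le> g x y" using False by (simp add: w_def)
      ultimately show ?thesis unfolding g_def by linarith
    qed
    show "?m \<le> w (x + s, y + t)"
      using to_v to_g by (auto simp: w_def)
  qed
  then have "v (x, y) \<le> w (x, y)" using x0 le y by (intro v_le) auto
  also have "\<dots> \<le> g x y"
    using le by (auto simp: w_def g_def)
  finally show ?thesis by (simp add: g_def)
qed

end

lemma growth_problem_swap: "growth_problem u C \<Longrightarrow> growth_problem (u \<circ> prod.swap) C"
  by (auto simp: growth_problem_def doubly_increasing_on_def quadrant_def)

context growth_problem
begin

lemma v_increment_y:
  assumes "0 \<le> y0" "y0 \<le> y" "0 \<le> x"
  shows "v (x, y) \<le> v (x, y0) + 2 * sqrt (C * (y - y0) * x)"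
proof -
  interpret swapped: growth_problem "u \<circ> prod.swap" C
    by (rule growth_problem_swap) unfold_locales
  show ?thesis
    using swapped.v_increment_x[OF assms] by (simp add: least_growing_swap)
qed

text \<open>The corner \<open>(a, y)\<close> splits the displacement into a horizontal and a
  vertical move; monotonicity supplies the absolute values.\<close>

lemma v_modulus:
  assumes "0 \<le> a" "0 \<le> b" "0 \<le> x" "0 \<le> y"
  shows "\<bar>v (x, y) - v (a, b)\<bar> \<le> 2 * sqrt (C * \<bar>x - a\<bar> * y) + 2 * sqrt (C * \<bar>y - b\<bar> * a)"
proof -
  have "\<bar>v (x, y) - v (a, y)\<bar> \<le> 2 * sqrt (C * \<bar>x - a\<bar> * y)"
    using v_increment_x[of a x y] v_increment_x[of x a y] v_mono[of a y x y] v_mono[of x y a y] assms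
    by (cases "a \<le> x") auto
  moreover have "\<bar>v (a, y) - v (a, b)\<bar> \<le> 2 * sqrt (C * \<bar>y - b\<bar> * a)"
    using v_increment_y[of b y a] v_increment_y[of y b a] v_mono[of a b a y] v_mono[of a y a b] assms
    by (cases "b \<le> y") auto
  ultimately show ?thesis by linarith
qed

lemma continuous_v: "continuous_on quadrant v"
  unfolding continuous_on_def
proof
  fix p assume "p \<in> quadrant"
  then obtain a b where p: "p = (a, b)" "0 \<le> a" "0 \<le> b" by (auto simp: quadrant_def)
  let ?F = "at p within quadrant"
  let ?h = "\<lambda>q. 2 * sqrt (C * \<bar>fst q - a\<bar> * snd q) + 2 * sqrt (C * \<bar>snd q - b\<bar> * a)"
  have "(?h \<longlongrightarrow> 2 * sqrt (C * \<bar>fst p - a\<bar> * snd p) + 2 * sqrt (C * \<bar>snd p - b\<bar> * a)) ?F"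
    by (intro tendsto_intros)
  then have h: "(?h \<longlongrightarrow> 0) ?F" by (simp add: p)
  have "eventually (\<lambda>q. norm (v q - v p) \<le> ?h q) ?F"
    using v_modulus[OF p(2,3)] by (auto simp: eventually_at_filter quadrant_def p(1) intro!: always_eventually)
  then have "((\<lambda>q. v q - v p) \<longlongrightarrow> 0) ?F"
    by (rule Lim_null_comparison[OF _ h])
  then show "(v \<longlongrightarrow> v p) ?F" by (simp add: LIM_zero_iff)
qed

section \<open>Directional derivatives where \<open>v\<close> lies below \<open>u\<close>\<close>

lemma v_directional_derivative:
  assumes nn: "0 \<le> x" "0 \<le> y" "0 \<le> s" "0 \<le> t" and lt: "v (x, y) < u (x, y)"
    and deriv: "((\<lambda>r. v (x + r * s, y + r * t)) has_real_derivative d) (at 0)"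
  shows "2 * sqrt (C * s * t) \<le> d"
proof -
  let ?k = "2 * sqrt (C * s * t)"
  let ?g = "\<lambda>r. v (x + r * s, y + r * t)"
  \<comment> \<open>Only the limit from the right is used, since the growth condition looks up and
    to the right.\<close>
  have lim: "((\<lambda>r. (?g r - ?g 0) / r) \<longlongrightarrow> d) (at_right 0)"
    using deriv by (simp add: has_field_derivative_iff filterlim_at_split)
  have "((\<lambda>r. v (x, y) + r * ?k) \<longlongrightarrow> v (x, y) + 0 * ?k) (at_right 0)"
    by (intro tendsto_intros)
  \<comment> \<open>For small \<open>r\<close> the cap \<open>u (x, y)\<close> is thus inactive in
    \<open>v_step\<close>.\<close>
  then have "eventually (\<lambda>r. v (x, y) + r * ?k < u (x, y)) (at_right 0)"
    using lt by (intro order_tendstoD(2)[of _ "v (x, y)"]) simp_all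
  moreover have "eventually (\<lambda>r. 0 < r) (at_right (0::real))"
    by (rule eventually_at_right_less)
  ultimately have "eventually (\<lambda>r. ?k \<le> (?g r - ?g 0) / r) (at_right 0)"
  proof eventually_elim
    case (elim r)
    \<comment> \<open>The gain is homogeneous of degree one in the step, so it survives division by
      \<open>r\<close>.\<close>
    have "C * (r * s) * (r * t) = r\<^sup>2 * (C * s * t)" by (simp add: power2_eq_square algebra_simps)
    then have "sqrt (C * (r * s) * (r * t)) = r * sqrt (C * s * t)"
      using elim by (simp add: real_sqrt_mult)
    then have "v (x, y) + r * ?k \<le> ?g r"
      using v_step[of x y "r * s" "r * t"] nn elim by (simp add: algebra_simps)
    then show ?case using elim by (simp add: field_simps)
  qed
  then show ?thesis
    using lim by (intro tendsto_lowerbound[OF lim]) auto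
qed

end

section \<open>From directional derivatives to the product of the partial derivatives\<close>

lemma product_ge_of_support_function:
  fixes a b C :: real
  assumes C: "0 < C" and supp: "\<And>s t. 0 \<le> s \<Longrightarrow> 0 \<le> t \<Longrightarrow> 2 * sqrt (C * s * t) \<le> a * s + b * t"
  shows "C \<le> a * b"
proof -
  have a0: "0 \<le> a" and b0: "0 \<le> b"
    using supp[of 1 0] supp[of 0 1] by auto
  have sq: "4 * C * s * t \<le> (a * s + b * t)\<^sup>2" if "0 \<le> s" "0 \<le> t" for s t
  proof -
    have "(2 * sqrt (C * s * t))\<^sup>2 \<le> (a * s + b * t)\<^sup>2"
      using supp[OF that] C that by (intro power_mono) auto
    then show ?thesis using C that by (simp add: power_mult_distrib)
  qed
  \<comment> \<open>With \<open>a = 0\<close> the right side of \<open>sq\<close> is independent of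
    \<open>s\<close> while the left side is linear in \<open>s\<close>; the witness makes the left
    side \<open>4 * (b\<^sup>2 + 1)\<close>.\<close>
  have a: "a \<noteq> 0"
  proof
    assume "a = 0"
    then have "4 * (b\<^sup>2 + 1) \<le> b\<^sup>2"
      using sq[of "(b\<^sup>2 + 1) / C" 1] C by simp
    then show False
      using zero_le_power2[of b] by (simp only: distrib_left)
  qed
  have b: "b \<noteq> 0"
  proof
    assume "b = 0"
    then have "4 * (a\<^sup>2 + 1) \<le> a\<^sup>2"
      using sq[of 1 "(a\<^sup>2 + 1) / C"] C by simp
    then show False
      using zero_le_power2[of a] by (simp only: distrib_left)
  qed
  \<comment> \<open>The choice \<open>s = b\<close>, \<open>t = a\<close> makes both summands equal
    to \<open>a * b\<close>, the equality case of the arithmetic-geometric mean inequality.\<close>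
  have "4 * C * b * a \<le> (a * b + b * a)\<^sup>2" using sq[of b a] a0 b0 by simp
  also have "\<dots> = 4 * (a * b) * (a * b)" by (simp add: power2_eq_square algebra_simps)
  finally have "C * (a * b) \<le> (a * b) * (a * b)" by (simp add: algebra_simps)
  moreover have "0 < a * b" using a b a0 b0 by simp
  ultimately show ?thesis by (rule mult_right_le_imp_le)
qed

lemma has_derivative_along_line:
  fixes f :: "real \<times> real \<Rightarrow> real"
  assumes "(f has_derivative D) (at (x, y))"
  shows "((\<lambda>r. f (x + r * s, y + r * t)) has_real_derivative D (s, t)) (at 0)"
proof -
  interpret D: bounded_linear D using assms by (rule has_derivative_bounded_linear)
  have line: "((\<lambda>r. (x + r * s, y + r * t)) has_derivative (\<lambda>r. (r * s, r * t))) (at 0)"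
    by (auto intro!: derivative_eq_intros)
  have "((\<lambda>r. f (x + r * s, y + r * t)) has_derivative (\<lambda>r. D (r * s, r * t))) (at 0)"
    using has_derivative_compose[OF line, of f D] assms by simp
  moreover have "D (r * s, r * t) = D (s, t) * r" for r
    using D.scaleR[of r "(s, t)"] by (simp add: mult.commute)
  ultimately show ?thesis by (simp add: has_field_derivative_def mult_commute_abs)
qed

lemma partial_x_eq:
  assumes "(f has_derivative D) (at (x, y))"
  shows "partial_x f x y = D (1, 0)"
proof -
  have "((\<lambda>r. f (x + r, y)) has_real_derivative D (1, 0)) (at 0)"
    using has_derivative_along_line[OF assms, of 1 0] by simp
  then have "((\<lambda>s. f (s, y)) has_real_derivative D (1, 0)) (at x)"
    using DERIV_shift[of "\<lambda>s. f (s, y)" "D (1, 0)" 0 x] by (simp add: add.commute)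
  then show ?thesis unfolding partial_x_def by (rule DERIV_imp_deriv)
qed

lemma partial_y_eq:
  assumes "(f has_derivative D) (at (x, y))"
  shows "partial_y f x y = D (0, 1)"
proof -
  have "((\<lambda>r. f (x, y + r)) has_real_derivative D (0, 1)) (at 0)"
    using has_derivative_along_line[OF assms, of 0 1] by simp
  then have "((\<lambda>t. f (x, t)) has_real_derivative D (0, 1)) (at y)"
    using DERIV_shift[of "\<lambda>t. f (x, t)" "D (0, 1)" 0 y] by (simp add: add.commute)
  then show ?thesis unfolding partial_y_def by (rule DERIV_imp_deriv)
qed

text \<open>Linearity of the total derivative turns the bounds on directional derivatives into the
  support function inequality for the pair of partial derivatives.\<close>

lemma (in growth_problem) partials_product_ge:
  assumes pos: "0 < x" "0 < y" and C: "0 < C" and lt: "v (x, y) < u (x, y)"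
    and diff: "v differentiable (at (x, y) within quadrant)"
  shows "C \<le> partial_x v x y * partial_y v x y"
proof -
  \<comment> \<open>At an interior point the derivative within the quadrant is the full derivative,
    which determines the two-sided partial derivatives.\<close>
  have "(x, y) \<in> interior quadrant"
    using pos by (simp add: quadrant_def interior_Times)
  then have "at (x, y) within quadrant = at (x, y)"
    by (rule at_within_interior)
  then obtain D where D: "(v has_derivative D) (at (x, y))"
    using diff unfolding differentiable_def by auto
  interpret D: bounded_linear D using D by (rule has_derivative_bounded_linear)
  have lin: "D (s, t) = D (1, 0) * s + D (0, 1) * t" for s t
  proof -
    have "D (s, t) = D (s *\<^sub>R (1, 0) + t *\<^sub>R (0, 1))" by simp
    also have "\<dots> = D (1, 0) * s + D (0, 1) * t"
      by (simp only: D.add D.scaleR real_scaleR_def mult.commute)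
    finally show ?thesis .
  qed
  have "2 * sqrt (C * s * t) \<le> D (1, 0) * s + D (0, 1) * t" if "0 \<le> s" "0 \<le> t" for s t
    using v_directional_derivative[OF _ _ that lt has_derivative_along_line[OF D]] pos by (simp add: lin[of s t])
  then show ?thesis
    unfolding partial_x_eq[OF D] partial_y_eq[OF D]
    by (rule product_ge_of_support_function[OF C])
qed

theorem theorem2p8:
  fixes u :: "real \<times> real \<Rightarrow> real"
  assumes u_nonneg: "\<And>p. p \<in> quadrant \<Longrightarrow> 0 \<le> u p"
    and u_incr: "doubly_increasing_on quadrant u"
    and u_axes: "\<And>t. 0 \<le> t \<Longrightarrow> u (0, t) = 0 \<and> u (t, 0) = 0"
  shows "\<forall>C>0. \<exists>v :: real \<times> real \<Rightarrow> real.
           continuous_on quadrant v \<and> doubly_increasing_on quadrant v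
         \<and> (\<forall>p\<in>quadrant. 0 \<le> v p \<and> v p \<le> u p)
         \<and> (\<forall>x y. (x, y) \<in> quadrant \<longrightarrow> v (x, y) \<noteq> u (x, y)
              \<longrightarrow> v differentiable (at (x, y) within quadrant)
              \<longrightarrow> C \<le> partial_x v x y * partial_y v x y)"
proof (intro allI impI)
  fix C :: real assume C: "C > 0"
  interpret growth_problem u C
    using u_nonneg u_incr C by unfold_locales auto
  have bounds: "0 \<le> v p \<and> v p \<le> u p" if "p \<in> quadrant" for p
    using that by (cases p) (auto simp: quadrant_def v_nonneg v_le_u)
  have "C \<le> partial_x v x y * partial_y v x y"
    if q: "(x, y) \<in> quadrant" and ne: "v (x, y) \<noteq> u (x, y)"
      and diff: "v differentiable (at (x, y) within quadrant)" for x y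
  proof -
    have "0 \<le> x" "0 \<le> y" using q by (auto simp: quadrant_def)
    \<comment> \<open>On the axes \<open>u\<close> vanishes, so \<open>0 \<le> v \<le> u\<close>
      forces \<open>v = u\<close> there.\<close>
    moreover have "x \<noteq> 0" "y \<noteq> 0"
      using bounds[OF q] ne u_axes[of x] u_axes[of y] calculation by auto
    ultimately show ?thesis
      using partials_product_ge[OF _ _ C _ diff] bounds[OF q] ne by simp
  qed
  moreover have "doubly_increasing_on quadrant v"
    by (auto simp: doubly_increasing_on_def quadrant_def intro: v_mono)
  ultimately show "\<exists>v. continuous_on quadrant v \<and> doubly_increasing_on quadrant v
         \<and> (\<forall>p\<in>quadrant. 0 \<le> v p \<and> v p \<le> u p)
         \<and> (\<forall>x y. (x, y) \<in> quadrant \<longrightarrow> v (x, y) \<noteq> u (x, y)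
              \<longrightarrow> v differentiable (at (x, y) within quadrant)
              \<longrightarrow> C \<le> partial_x v x y * partial_y v x y)"
    using continuous_v bounds by blast
qed

end
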